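(* Let $p\ge 1$, let $h_1,\dots,h_p:\mathbb{R}^n\to\mathbb{R}$ be continuously differentiable, let $\phi(x)=\max_{1\le j\le p}|h_j(x)|$ and $\Omega=\{x\in\mathbb{R}^n\mid h_j(x)=0,\ j=1,\dots,p\}$, and let $x^*\in\Omega$ (so $\phi(x^* )=0$). Assume that the linear independence constraint qualification (LICQ) holds at $x^*$, i.e. the gradients $\nabla h_1(x^* ),\dots,\nabla h_p(x^* )$ are linearly independent. Then the Unified Separation Condition (USC) holds at $x^*$, i.e. there exist a neighborhood $B$ of $x^*$ and a constant $a>0$ such that $$\operatorname{dist}\bigl(0,\partial\phi(x)\bigr)\ge a\quad\text{for all } x\in B\setminus\Omega.$$
   Context: For $A\subseteq\mathbb{R}^n$, $\operatorname{dist}(0,A)=\inf_{v\in A}\|v\|_2$. The subdifferential $\partial\phi(x)$ is the convex compact set for which the directional derivative satisfies $\phi'(x;d)=\max_{v\in\partial\phi(x)}\langle v,d\rangle$ for all $d\in\mathbb{R}^n$. For $\phi=\max_j|h_j|$ with continuously differentiable $h_j$ and a point $x\notin\Omega$ (equivalently $\phi(x)>0$), it is given by $\partial\phi(x)=\operatorname{conv}\{\operatorname{sign}(h_j(x))\nabla h_j(x)\mid j\in\{1,\dots,p\},\ |h_j(x)|=\phi(x)\}$. *)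

theory Defs
  imports "HOL-Analysis.Analysis"
begin

definition gradient :: "(real ^ 'n \<Rightarrow> real) \<Rightarrow> real ^ 'n \<Rightarrow> real ^ 'n" where
  "gradient f x = (THE D. GDERIV f x :> D)"

definition continuously_differentiable :: "(real ^ 'n \<Rightarrow> real) \<Rightarrow> bool" where
  "continuously_differentiable f \<longleftrightarrow>
     (\<forall>x. f differentiable (at x)) \<and> continuous_on UNIV (gradient f)"

text \<open>The one-sided directional derivative of \<open>f\<close> at \<open>x\<close> in direction \<open>d\<close> exists and equals \<open>l\<close>.\<close>

definition has_directional_derivative ::
    "(real ^ 'n \<Rightarrow> real) \<Rightarrow> real ^ 'n \<Rightarrow> real ^ 'n \<Rightarrow> real \<Rightarrow> bool" where
  "has_directional_derivative f x d l \<longleftrightarrow>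
     ((\<lambda>t. (f (x + t *\<^sub>R d) - f x) / t) \<longlongrightarrow> l) (at_right 0)"

text \<open>The inner existential says that the maximum of \<open>v \<bullet> d\<close> over \<open>S\<close> is attained (so \<open>S\<close> is
  nonempty) and equals the directional derivative.\<close>

definition is_subdifferential ::
    "(real ^ 'n \<Rightarrow> real) \<Rightarrow> real ^ 'n \<Rightarrow> (real ^ 'n) set \<Rightarrow> bool" where
  "is_subdifferential f x S \<longleftrightarrow> convex S \<and> compact S \<and>
     (\<forall>d. \<exists>v\<in>S. (\<forall>w\<in>S. w \<bullet> d \<le> v \<bullet> d) \<and> has_directional_derivative f x d (v \<bullet> d))"

text \<open>Well defined whenever such a set exists, by the uniqueness lemma
  \<open>is_subdifferential_unique\<close> below.\<close>

definition subdifferential ::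
    "(real ^ 'n \<Rightarrow> real) \<Rightarrow> real ^ 'n \<Rightarrow> (real ^ 'n) set" where
  "subdifferential f x = (THE S. is_subdifferential f x S)"

definition max_abs :: "nat \<Rightarrow> (nat \<Rightarrow> real ^ 'n \<Rightarrow> real) \<Rightarrow> real ^ 'n \<Rightarrow> real" where
  "max_abs p h x = Max ((\<lambda>j. \<bar>h j x\<bar>) ` {1..p})"

definition common_zeros :: "nat \<Rightarrow> (nat \<Rightarrow> real ^ 'n \<Rightarrow> real) \<Rightarrow> (real ^ 'n) set" where
  "common_zeros p h = {x. \<forall>j\<in>{1..p}. h j x = 0}"

text \<open>Linear independence of the gradients as an indexed family: \<open>independent\<close> is a property of
  sets, so injectivity is needed to exclude repeated gradients.\<close>

definition LICQ :: "nat \<Rightarrow> (nat \<Rightarrow> real ^ 'n \<Rightarrow> real) \<Rightarrow> real ^ 'n \<Rightarrow> bool" where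
  "LICQ p h x \<longleftrightarrow> inj_on (\<lambda>j. gradient (h j) x) {1..p} \<and>
     independent ((\<lambda>j. gradient (h j) x) ` {1..p})"

text \<open>\<open>infdist 0 A\<close> is the infimum of \<open>norm v\<close> over \<open>v \<in> A\<close> for nonempty \<open>A\<close>; the norm of
  \<open>real ^ 'n\<close> is the Euclidean one.\<close>

definition USC :: "nat \<Rightarrow> (nat \<Rightarrow> real ^ 'n \<Rightarrow> real) \<Rightarrow> real ^ 'n \<Rightarrow> bool" where
  "USC p h xs \<longleftrightarrow> (\<exists>B a. open B \<and> xs \<in> B \<and> a > 0 \<and>
     (\<forall>x\<in>B - common_zeros p h. infdist 0 (subdifferential (max_abs p h) x) \<ge> a))"

lemma gradient_eq:
  assumes "GDERIV f x :> D"
  shows "gradient f x = D"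
  unfolding gradient_def
proof (rule the_equality[where P = "\<lambda>D. GDERIV f x :> D", OF assms])
  fix E assume "GDERIV f x :> E"
  with assms have "(\<lambda>h. h \<bullet> E) = (\<lambda>h. h \<bullet> D)"
    unfolding gderiv_def by (intro has_derivative_unique)
  then have "(E - D) \<bullet> E = (E - D) \<bullet> D"
    by (rule fun_cong)
  then have "(E - D) \<bullet> (E - D) = 0"
    by (simp add: inner_diff_right)
  then show "E = D"
    by simp
qed

lemma GDERIV_gradient:
  fixes f :: "real ^ 'n \<Rightarrow> real"
  assumes "f differentiable (at x)"
  shows "GDERIV f x :> gradient f x"
proof -
  obtain f' where f': "(f has_derivative f') (at x)"
    using assms by (auto simp: differentiable_def)
  then interpret bounded_linear f' by (rule has_derivative_bounded_linear)
  have "f' = (\<lambda>d. d \<bullet> (adjoint f' 1))"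
    using adjoint_works[OF linear_axioms, of _ 1] by (auto simp: fun_eq_iff)
  with f' have "GDERIV f x :> adjoint f' 1"
    by (simp add: gderiv_def)
  then show ?thesis by (simp add: gradient_eq)
qed

lemma is_subdifferential_unique:
  assumes S: "is_subdifferential f x S" and T: "is_subdifferential f x T"
  shows "S = T"
proof -
  have sub: "S \<subseteq> T" if S: "is_subdifferential f x S" and T: "is_subdifferential f x T" for S T
  proof
    fix s assume s: "s \<in> S"
    show "s \<in> T"
    proof (rule ccontr)
      assume "s \<notin> T"
      moreover have "convex T" "closed T"
        using T by (auto simp: is_subdifferential_def compact_imp_closed)
      ultimately obtain a b where ab: "a \<bullet> s < b" "\<And>t. t \<in> T \<Longrightarrow> a \<bullet> t > b"
        using separating_hyperplane_closed_point[of T s] by blast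
      obtain v where v: "\<And>w. w \<in> S \<Longrightarrow> w \<bullet> (-a) \<le> v \<bullet> (-a)"
        "has_directional_derivative f x (-a) (v \<bullet> (-a))"
        using S unfolding is_subdifferential_def by meson
      obtain u where u: "u \<in> T" "has_directional_derivative f x (-a) (u \<bullet> (-a))"
        using T unfolding is_subdifferential_def by meson
      have "v \<bullet> (-a) = u \<bullet> (-a)"
        using v(2) u(2) unfolding has_directional_derivative_def
        by (intro tendsto_unique[OF trivial_limit_at_right_real])
      with v(1)[OF s] ab(1) ab(2)[OF u(1)] show False
        by (simp add: inner_commute)
    qed
  qed
  from sub[OF S T] sub[OF T S] show ?thesis by blast
qed

lemma subdifferential_eq:
  "is_subdifferential f x S \<Longrightarrow> subdifferential f x = S"
  unfolding subdifferential_def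
  by (rule the_equality) (assumption, erule is_subdifferential_unique, assumption)

end

theory Submission
  imports Defs
begin

text \<open>At a point outside \<open>\<Omega>\<close> the subdifferential of \<open>\<phi>\<close> is the convex hull of the
  vectors \<open>sgn (h\<^sub>j x) \<nabla>h\<^sub>j x\<close> over the active indices. LICQ yields vectors \<open>w\<^sub>j\<close> dual to the
  gradients at \<open>x\<^sup>*\<close>; then \<open>w = \<Sum>\<^sub>j sgn (h\<^sub>j x) w\<^sub>j\<close> has inner product \<open>1\<close> with each
  \<open>sgn (h\<^sub>j x) \<nabla>h\<^sub>j x\<^sup>*\<close>, hence at least \<open>1/2\<close> with each generator of the hull when \<open>x\<close> is close
  to \<open>x\<^sup>*\<close>. Since \<open>norm w\<close> is bounded independently of \<open>x\<close>, the hull stays away from \<open>0\<close>.\<close>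

lemma GDERIV_directional_tendsto:
  fixes f :: "real ^ 'n \<Rightarrow> real"
  assumes "GDERIV f x :> g"
  shows "((\<lambda>t. (f (x + t *\<^sub>R d) - f x) / t) \<longlongrightarrow> g \<bullet> d) (at_right 0)"
proof -
  \<comment> \<open>The base point is written \<open>x + 0 *\<^sub>R d\<close> to match the value at
    0 of the line in the chain rule.\<close>
  have "(f has_derivative (\<lambda>y. y \<bullet> g)) (at (x + 0 *\<^sub>R d))"
    using assms by (simp add: gderiv_def)
  moreover have "((\<lambda>t. x + t *\<^sub>R d) has_derivative (\<lambda>t. t *\<^sub>R d)) (at 0)"
    by (auto intro!: derivative_eq_intros)
  ultimately have "((\<lambda>t. f (x + t *\<^sub>R d)) has_derivative (\<lambda>t. (t *\<^sub>R d) \<bullet> g)) (at 0)"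
    by (rule has_derivative_compose[rotated])
  then have "((\<lambda>t. f (x + t *\<^sub>R d)) has_real_derivative g \<bullet> d) (at 0)"
    by (simp add: has_field_derivative_def inner_commute mult_commute_abs)
  then have "((\<lambda>t. (f (x + t *\<^sub>R d) - f x) / t) \<longlongrightarrow> g \<bullet> d) (at 0)"
    by (simp add: DERIV_def)
  then show ?thesis
    by (rule filterlim_mono) (simp_all add: at_le)
qed

lemma GDERIV_abs:
  assumes "GDERIV f x :> g" and "f x \<noteq> 0"
  shows "GDERIV (\<lambda>y. \<bar>f y\<bar>) x :> sgn (f x) *\<^sub>R g"
proof -
  \<comment> \<open>On the reals \<open>norm\<close> is the absolute value, so this is the gradient
    of the norm away from 0.\<close>
  have "DERIV abs (f x) :> sgn (f x)"
    using GDERIV_norm[OF assms(2)]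
    by (simp add: gderiv_def has_field_derivative_def mult_commute_abs)
  with assms(1) show ?thesis by (rule GDERIV_DERIV_compose)
qed

text \<open>A squeeze. From below, the maximum dominates \<open>f k\<close> and agrees with it at
  \<open>x\<close>, so its difference quotients dominate those of \<open>f k\<close>. From above, it
  suffices to bound each \<open>f j\<close> separately, since at every point the maximum is attained
  by one of finitely many indices: active ones have slope at most \<open>g k \<bullet> d\<close>,
  inactive ones stay strictly below by continuity.\<close>

lemma has_directional_derivative_Max:
  fixes f :: "'a \<Rightarrow> real ^ 'n \<Rightarrow> real"
  assumes fin: "finite I"
    and cont: "\<And>j. j \<in> I \<Longrightarrow> isCont (f j) x"
    and der: "\<And>j. \<lbrakk>j \<in> I; f j x = Max ((\<lambda>j. f j x) ` I)\<rbrakk> \<Longrightarrow> GDERIV (f j) x :> g j"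
    and k: "k \<in> I" "f k x = Max ((\<lambda>j. f j x) ` I)"
    and max: "\<And>j. \<lbrakk>j \<in> I; f j x = Max ((\<lambda>j. f j x) ` I)\<rbrakk> \<Longrightarrow> g j \<bullet> d \<le> g k \<bullet> d"
  shows "has_directional_derivative (\<lambda>y. Max ((\<lambda>j. f j y) ` I)) x d (g k \<bullet> d)"
proof -
  define F where "F y = Max ((\<lambda>j. f j y) ` I)" for y
  have pos: "eventually (\<lambda>t. t > (0::real)) (at_right 0)"
    by (simp add: eventually_at_right_less)
  have "eventually (\<lambda>t. l < (F (x + t *\<^sub>R d) - F x) / t) (at_right 0)" if "l < g k \<bullet> d" for l
    using order_tendstoD(1)[OF GDERIV_directional_tendsto[OF der[OF k]] that] pos
  proof eventually_elim
    case (elim t)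
    have "f k (x + t *\<^sub>R d) \<le> F (x + t *\<^sub>R d)"
      using fin k(1) by (auto simp: F_def)
    then have "(f k (x + t *\<^sub>R d) - f k x) / t \<le> (F (x + t *\<^sub>R d) - F x) / t"
      using elim(2) k(2) by (intro divide_right_mono) (auto simp: F_def)
    with elim(1) show ?case by linarith
  qed
  moreover have "eventually (\<lambda>t. (F (x + t *\<^sub>R d) - F x) / t < u) (at_right 0)"
    if u: "g k \<bullet> d < u" for u
  proof -
    have "eventually (\<lambda>t. (f j (x + t *\<^sub>R d) - F x) / t < u) (at_right 0)" if j: "j \<in> I" for j
    proof (cases "f j x = F x")
      case True
      then have "g j \<bullet> d < u" "GDERIV (f j) x :> g j"
        using max[OF j] der[OF j] u by (auto simp: F_def)
      then show ?thesis
        using order_tendstoD(2)[OF GDERIV_directional_tendsto, of "f j" x "g j" d u] True by simp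
    next
      case False
      then have less: "f j x - F x < 0"
        using fin j by (simp add: F_def less_le)
      have "((\<lambda>t. x + t *\<^sub>R d) \<longlongrightarrow> x + 0 *\<^sub>R d) (at_right 0)"
        by (intro tendsto_intros)
      then have "((\<lambda>t. f j (x + t *\<^sub>R d)) \<longlongrightarrow> f j x) (at_right 0)"
        using isCont_tendsto_compose[OF cont[OF j]] by simp
      \<comment> \<open>For \<open>t > 0\<close> the desired bound on the quotient is equivalent to
        negativity of this expression, whose limit is the negative gap
        \<open>f j x - F x\<close>.\<close>
      then have "((\<lambda>t. f j (x + t *\<^sub>R d) - F x - u * t) \<longlongrightarrow> f j x - F x - u * 0) (at_right 0)"
        by (intro tendsto_intros)
      then have "eventually (\<lambda>t. f j (x + t *\<^sub>R d) - F x - u * t < 0) (at_right 0)"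
        using less by (intro order_tendstoD(2)) auto
      with pos show ?thesis
        by eventually_elim (simp add: divide_less_eq)
    qed
    then have "eventually (\<lambda>t. \<forall>j\<in>I. (f j (x + t *\<^sub>R d) - F x) / t < u) (at_right 0)"
      using fin by (simp add: eventually_ball_finite_distrib)
    then show ?thesis
    proof eventually_elim
      case (elim t)
      have "F (x + t *\<^sub>R d) \<in> (\<lambda>j. f j (x + t *\<^sub>R d)) ` I"
        unfolding F_def using fin k(1) by (intro Max_in) auto
      with elim show ?case by auto
    qed
  qed
  ultimately show ?thesis
    unfolding has_directional_derivative_def F_def[symmetric] by (intro order_tendstoI)
qed

text \<open>A linear functional on the hull of finitely many points is maximal at one of them, and
  the maximal value is the directional derivative found above. Differentiability is asked of active
  functions only, because \<open>\<bar>h j y\<bar>\<close> may have a kink where \<open>h j\<close>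
  vanishes.\<close>

lemma is_subdifferential_Max:
  fixes f :: "'a \<Rightarrow> real ^ 'n \<Rightarrow> real"
  assumes fin: "finite I" and "I \<noteq> {}"
    and cont: "\<And>j. j \<in> I \<Longrightarrow> isCont (f j) x"
    and der: "\<And>j. \<lbrakk>j \<in> I; f j x = Max ((\<lambda>j. f j x) ` I)\<rbrakk> \<Longrightarrow> GDERIV (f j) x :> g j"
  shows "is_subdifferential (\<lambda>y. Max ((\<lambda>j. f j y) ` I)) x
           (convex hull (g ` {j \<in> I. f j x = Max ((\<lambda>j. f j x) ` I)}))"
proof -
  define A where "A = {j \<in> I. f j x = Max ((\<lambda>j. f j x) ` I)}"
  have "Max ((\<lambda>j. f j x) ` I) \<in> (\<lambda>j. f j x) ` I"
    using assms by (intro Max_in) auto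
  then have A: "finite A" "A \<noteq> {}"
    using fin by (auto simp: A_def)
  have "\<exists>v\<in>convex hull (g ` A). (\<forall>w\<in>convex hull (g ` A). w \<bullet> d \<le> v \<bullet> d) \<and>
      has_directional_derivative (\<lambda>y. Max ((\<lambda>j. f j y) ` I)) x d (v \<bullet> d)" for d
  proof -
    have "Max ((\<lambda>j. g j \<bullet> d) ` A) \<in> (\<lambda>j. g j \<bullet> d) ` A"
      using A by (intro Max_in) auto
    then obtain k where k: "k \<in> A" "g k \<bullet> d = Max ((\<lambda>j. g j \<bullet> d) ` A)"
      by auto
    then have max: "g j \<bullet> d \<le> g k \<bullet> d" if "j \<in> A" for j
      using A(1) that by simp
    have "convex hull (g ` A) \<subseteq> {w. d \<bullet> w \<le> g k \<bullet> d}"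
      using max by (intro hull_minimal convex_halfspace_le) (auto simp: inner_commute)
    moreover have "has_directional_derivative (\<lambda>y. Max ((\<lambda>j. f j y) ` I)) x d (g k \<bullet> d)"
      using k(1) max
      by (intro has_directional_derivative_Max[OF fin cont der]) (auto simp: A_def)
    moreover have "g k \<in> convex hull (g ` A)"
      using k(1) by (intro hull_inc) auto
    ultimately show ?thesis
      by (intro bexI[of _ "g k"]) (auto simp: inner_commute[of d])
  qed
  then show ?thesis
    unfolding is_subdifferential_def A_def[symmetric]
    using A(1) by (auto intro: finite_imp_compact_convex_hull)
qed

lemma max_abs_pos:
  assumes "x \<notin> common_zeros p h"
  shows "max_abs p h x > 0"
proof -
  obtain j where j: "j \<in> {1..p}" "h j x \<noteq> 0"
    using assms by (auto simp: common_zeros_def)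
  then have "\<bar>h j x\<bar> \<le> max_abs p h x"
    unfolding max_abs_def by (intro Max_ge) auto
  with j(2) show ?thesis by linarith
qed

text \<open>Outside the common zeros the maximum is positive, so each active \<open>h j\<close> is
  nonzero at \<open>x\<close> and its absolute value is differentiable there.\<close>

lemma subdifferential_max_abs:
  assumes "p \<ge> 1"
    and diff: "\<And>j. j \<in> {1..p} \<Longrightarrow> h j differentiable (at x)"
    and x: "x \<notin> common_zeros p h"
  shows "subdifferential (max_abs p h) x =
    convex hull ((\<lambda>j. sgn (h j x) *\<^sub>R gradient (h j) x) ` {j \<in> {1..p}. \<bar>h j x\<bar> = max_abs p h x})"
proof (rule subdifferential_eq)
  have eq: "max_abs p h = (\<lambda>y. Max ((\<lambda>j. \<bar>h j y\<bar>) ` {1..p}))"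
    by (simp add: max_abs_def fun_eq_iff)
  have "GDERIV (\<lambda>y. \<bar>h j y\<bar>) x :> sgn (h j x) *\<^sub>R gradient (h j) x"
    if "j \<in> {1..p}" "\<bar>h j x\<bar> = Max ((\<lambda>j. \<bar>h j x\<bar>) ` {1..p})" for j
    using that max_abs_pos[OF x]
    by (intro GDERIV_abs GDERIV_gradient diff) (auto simp: max_abs_def)
  moreover have "isCont (\<lambda>y. \<bar>h j y\<bar>) x" if "j \<in> {1..p}" for j
    using diff[OF that] by (intro continuous_intros differentiable_imp_continuous_within)
  ultimately show "is_subdifferential (max_abs p h) x
    (convex hull ((\<lambda>j. sgn (h j x) *\<^sub>R gradient (h j) x) `
      {j \<in> {1..p}. \<bar>h j x\<bar> = max_abs p h x}))"
    unfolding eq using \<open>p \<ge> 1\<close>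
    by (intro is_subdifferential_Max[where f = "\<lambda>j y. \<bar>h j y\<bar>"]) auto
qed

text \<open>Values on an independent set extend to a linear functional \<open>l\<close>, and
  \<open>adjoint l 1\<close> is the vector representing \<open>l\<close>. Injectivity turns equality
  of vectors into equality of indices.\<close>

lemma independent_family_dual_vectors:
  fixes g :: "'a \<Rightarrow> 'b :: euclidean_space"
  assumes inj: "inj_on g I" and indep: "independent (g ` I)"
  obtains w where "\<And>i j. \<lbrakk>i \<in> I; j \<in> I\<rbrakk> \<Longrightarrow> w i \<bullet> g j = (if i = j then 1 else 0)"
proof -
  have "\<exists>w. \<forall>j\<in>I. w \<bullet> g j = (if i = j then 1 else 0)" if "i \<in> I" for i
  proof -
    obtain l :: "'b \<Rightarrow> real" where l: "linear l" "\<And>y. y \<in> g ` I \<Longrightarrow> l y = (if y = g i then 1 else 0)"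
      using linear_independent_extend[OF indep, of "\<lambda>y. if y = g i then 1 else 0"] by auto
    have "adjoint l 1 \<bullet> g j = l (g j)" for j
      using adjoint_works[OF l(1), of "g j" 1] by (simp add: inner_commute)
    then show ?thesis
      using l(2) that inj by (intro exI[of _ "adjoint l 1"]) (auto simp: inj_on_eq_iff)
  qed
  then show thesis using that by metis
qed

text \<open>The half-space \<open>w \<bullet> y \<ge> c\<close> is convex, so it contains the whole
  hull; Cauchy-Schwarz then converts the bound into one on the norm.\<close>

lemma convex_hull_norm_lower_bound:
  fixes S :: "'a :: real_inner set"
  assumes "\<And>y. y \<in> S \<Longrightarrow> c \<le> w \<bullet> y" and "norm w \<le> K" and "K > 0"
    and v: "v \<in> convex hull S"
  shows "c / K \<le> norm v"
proof -
  have "convex hull S \<subseteq> {y. w \<bullet> y \<ge> c}"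
    using assms(1) by (intro hull_minimal convex_halfspace_ge) auto
  with v have "c \<le> w \<bullet> v" by auto
  also have "\<dots> \<le> norm w * norm v" by (rule norm_cauchy_schwarz)
  also have "\<dots> \<le> K * norm v" using assms(2) by (intro mult_right_mono) auto
  finally show ?thesis using \<open>K > 0\<close> by (simp add: divide_le_eq mult.commute)
qed

theorem theorem4p5:
  fixes p :: nat and h :: "nat \<Rightarrow> real ^ 'n \<Rightarrow> real" and xs :: "real ^ 'n"
  assumes "p \<ge> 1"
    and "\<And>j. j \<in> {1..p} \<Longrightarrow> continuously_differentiable (h j)"
    and "xs \<in> common_zeros p h"
    and "LICQ p h xs"
  shows "USC p h xs"
proof -
  let ?g = "\<lambda>j. gradient (h j)"
  obtain w where w: "\<And>i j. \<lbrakk>i \<in> {1..p}; j \<in> {1..p}\<rbrakk> \<Longrightarrow> w i \<bullet> ?g j xs = (if i = j then 1 else 0)"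
    using independent_family_dual_vectors[of "\<lambda>j. ?g j xs" "{1..p}"] \<open>LICQ p h xs\<close>
    unfolding LICQ_def by blast
  \<comment> \<open>The sum bounds every combination of the \<open>w i\<close> with coefficients in
    [-1, 1]; adding 1 makes \<open>K\<close> visibly positive.\<close>
  define K where "K = (\<Sum>i = 1..p. norm (w i)) + 1"
  have K: "K > 0"
    unfolding K_def by (intro add_nonneg_pos sum_nonneg) auto
  \<comment> \<open>The radius is chosen so that a vector of norm at most \<open>K\<close> has inner
    product at most 1/2 in absolute value with the change of each gradient.\<close>
  define B where "B = (\<Inter>j\<in>{1..p}. {x. norm (?g j x - ?g j xs) < 1 / (2 * K)})"
  have "continuous_on UNIV (?g j)" if "j \<in> {1..p}" for j
    using assms(2)[OF that] by (simp add: continuously_differentiable_def)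
  then have "open B"
    unfolding B_def by (intro open_INT open_Collect_less ballI continuous_intros) auto
  moreover have "xs \<in> B"
    using K by (simp add: B_def)
  moreover have "1 / 2 / K \<le> infdist 0 (subdifferential (max_abs p h) x)"
    if x: "x \<in> B - common_zeros p h" for x
  proof -
    define A where "A = {j \<in> {1..p}. \<bar>h j x\<bar> = max_abs p h x}"
    define G where "G = (\<lambda>j. sgn (h j x) *\<^sub>R ?g j x) ` A"
    have sub: "subdifferential (max_abs p h) x = convex hull G"
      unfolding G_def A_def using x assms(1,2)
      by (intro subdifferential_max_abs) (auto simp: continuously_differentiable_def)
    \<comment> \<open>Some index is active. This matters because \<open>infdist\<close> to the empty
      set is 0 by convention.\<close>
    have "max_abs p h x \<in> (\<lambda>j. \<bar>h j x\<bar>) ` {1..p}"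
      unfolding max_abs_def using \<open>p \<ge> 1\<close> by (intro Max_in) auto
    then have "G \<noteq> {}"
      by (auto simp: G_def A_def)
    define u where "u = (\<Sum>i = 1..p. sgn (h i x) *\<^sub>R w i)"
    have "norm u \<le> (\<Sum>i = 1..p. norm (w i))"
      unfolding u_def by (intro sum_norm_le) (simp add: abs_sgn_eq)
    then have u: "norm u \<le> K"
      by (simp add: K_def)
    have "1 / 2 \<le> u \<bullet> y" if "y \<in> G" for y
    proof -
      from that obtain j where j: "j \<in> {1..p}" "\<bar>h j x\<bar> = max_abs p h x"
        and y: "y = sgn (h j x) *\<^sub>R ?g j x"
        by (auto simp: G_def A_def)
      have s: "\<bar>sgn (h j x)\<bar> = 1" "sgn (h j x) * sgn (h j x) = 1"
        using max_abs_pos[of x p h] x j(2) by (auto simp: abs_sgn_eq sgn_if)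
      have "u \<bullet> ?g j xs = (\<Sum>i = 1..p. if i = j then sgn (h j x) else 0)"
        unfolding u_def inner_sum_left using w j(1) by (intro sum.cong) auto
      also have "\<dots> = sgn (h j x)"
        using j(1) by simp
      \<comment> \<open>Split the gradient at \<open>x\<close> into the one at \<open>xs\<close>
        plus the change; the former contributes the square of a sign, which is 1 as \<open>j\<close>
        is active.\<close>
      finally have "u \<bullet> y = 1 + sgn (h j x) * (u \<bullet> (?g j x - ?g j xs))"
        using s(2) by (simp add: y algebra_simps)
      moreover have "\<bar>sgn (h j x) * (u \<bullet> (?g j x - ?g j xs))\<bar> \<le> 1 / 2"
      proof -
        have "\<bar>u \<bullet> (?g j x - ?g j xs)\<bar> \<le> norm u * norm (?g j x - ?g j xs)"
          by (rule Cauchy_Schwarz_ineq2)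
        also have "\<dots> \<le> K * (1 / (2 * K))"
          using u K x j(1) by (intro mult_mono) (auto simp: B_def less_imp_le)
        finally show ?thesis
          using K s(1) by (simp add: abs_mult)
      qed
      ultimately show ?thesis by linarith
    qed
    then have "1 / 2 / K \<le> norm v" if "v \<in> convex hull G" for v
      using u K that by (rule convex_hull_norm_lower_bound)
    then show ?thesis
      unfolding sub using \<open>G \<noteq> {}\<close>
      by (subst infdist_notempty) (auto intro!: cINF_greatest)
  qed
  ultimately show ?thesis
    unfolding USC_def using K by (intro exI[of _ B] exI[of _ "1 / 2 / K"]) auto
qed

end
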